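(* Let $X$ and $Y$ be two Banach spaces and let $G:X\longrightarrow Y$ be a Daugavet center. Assume that $Y$ is separable. Then, given $u\in B_{X^{**}}$ and $\{g_n:n\in\mathbb N\}\subseteq S_{X^*}$, there exists $v\in S_{X^{**}}$ such that (1) $v(g_n)=u(g_n)$ holds for every $n\in\mathbb N$, and (2) $\|G^{**}(v)+y\|=1+\|y\|$ holds for every $y\in Y$. In particular, given any non-empty relatively $w^*$-open subset $W$ of $B_{X^{**}}$ there exists $v\in W$ satisfying (2).
   Context: All Banach spaces are real. $B_X$ and $S_X$ denote the closed unit ball and the unit sphere of $X$. $Y$ is regarded as a subspace of $Y^{**}$ via the canonical embedding, and $G^{**}:X^{**}\to Y^{**}$ is the biadjoint of $G$. A bounded linear operator $G:X\to Y$ is a Daugavet center if $\|G+T\|=\|G\|+\|T\|$ holds for every rank-one operator $T:X\to Y$.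
   Formalization: The formal theorem adds the hypothesis ‖G‖ = 1. Without it the claim fails: G = 2·Id on C[0,1] is a Daugavet center, but (2) with y = 0 would force 2‖v‖ = 1 for v in the unit sphere; the claim fails likewise for every G with ‖G‖ ≠ 1. *)

theory Defs
  imports "HOL-Analysis.Analysis"
begin

type_synonym 'a dual = "'a \<Rightarrow>\<^sub>L real"
type_synonym 'a bidual = "'a dual dual"

lift_definition canonical_embedding :: "'a::real_normed_vector \<Rightarrow> 'a bidual"
  is "\<lambda>x f. blinfun_apply f x"
  by (rule bounded_linear_intros bounded_linear_ident)+

lift_definition dual_adjoint ::
  "('a::real_normed_vector \<Rightarrow>\<^sub>L 'b::real_normed_vector) \<Rightarrow> 'b dual \<Rightarrow>\<^sub>L 'a dual"
  is "\<lambda>G f. f o\<^sub>L G"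
  by (rule bounded_linear_intros bounded_linear_ident)+

definition biadjoint ::
  "('a::real_normed_vector \<Rightarrow>\<^sub>L 'b::real_normed_vector) \<Rightarrow> 'a bidual \<Rightarrow>\<^sub>L 'b bidual"
  where "biadjoint G = dual_adjoint (dual_adjoint G)"

definition rank_one ::
  "('a::real_normed_vector \<Rightarrow>\<^sub>L 'b::real_normed_vector) \<Rightarrow> bool"
  where "rank_one T \<longleftrightarrow> dim (range (blinfun_apply T)) = 1"

definition daugavet_center ::
  "('a::real_normed_vector \<Rightarrow>\<^sub>L 'b::real_normed_vector) \<Rightarrow> bool"
  where "daugavet_center G \<longleftrightarrow> (\<forall>T. rank_one T \<longrightarrow> norm (G + T) = norm G + norm T)"

text \<open>The strong operator topology is the topology of pointwise convergence. For the scalar-valued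
  operators on \<open>'a\<close>, i.e. the elements of the dual of \<open>'a\<close>, this is the weak-* topology.\<close>

abbreviation weak_star_topology :: "'a::real_normed_vector dual topology"
  where "weak_star_topology \<equiv> strong_operator_topology"

end

theory Submission
  imports Defs
begin

text \<open>A Daugavet center \<open>G\<close> of norm one provides, in any slice of the unit ball and for finitely
  many \<open>z\<close>, a point \<open>x\<close> with \<open>\<parallel>z + G x\<parallel>\<close> almost equal to \<open>\<parallel>z\<parallel> + 1\<close>. Choose points \<open>x\<^sub>0, x\<^sub>1, \<dots>\<close> one after
  the other so that, for each \<open>y\<^sub>m\<close> from a dense sequence, the norm of \<open>y\<^sub>m + G x\<^sub>m + \<dots> + G x\<^sub>n\<close> is almost
  \<open>\<parallel>y\<^sub>m\<parallel> + (n - m + 1)\<close>; a limit of norming functionals is then almost norming for \<open>y\<^sub>m\<close> and almost \<open>1\<close> on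
  all \<open>G x\<^sub>n\<close>, \<open>n \<ge> m\<close>, and hence also on \<open>G\<^sup>*\<^sup>* v\<close> for every weak-* cluster point \<open>v\<close> of averages of
  the \<open>x\<^sub>n\<close>. The freedom to choose the slices is used to steer the averages: taking \<open>x\<^sub>n\<close> almost maximal
  for the functional that points from the current average to \<open>u\<close> (a Frank--Wolfe argument) makes
  the averages converge to \<open>u(g\<^sub>i)\<close> on every \<open>g\<^sub>i\<close>.\<close>

subsection \<open>Sublinear functionals and the Hahn--Banach theorem\<close>

definition sublinear :: "('a::real_vector \<Rightarrow> real) \<Rightarrow> bool"
  where "sublinear p \<longleftrightarrow>
    (\<forall>x y. p (x + y) \<le> p x + p y) \<and> (\<forall>c\<ge>0. \<forall>x. p (c *\<^sub>R x) = c * p x)"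

lemma sublinear_add: "sublinear p \<Longrightarrow> p (x + y) \<le> p x + p y"
  by (simp add: sublinear_def)

lemma sublinear_scaleR: "sublinear p \<Longrightarrow> 0 \<le> c \<Longrightarrow> p (c *\<^sub>R x) = c * p x"
  by (simp add: sublinear_def)

lemma sublinear_zero: "sublinear p \<Longrightarrow> p 0 = 0"
  using sublinear_scaleR[of p 0 0] by simp

lemma sublinear_uminus: "sublinear p \<Longrightarrow> - p (- x) \<le> p x"
  using sublinear_add[of p x "- x"] sublinear_zero[of p] by simp

text \<open>For positive scalars one inequality suffices: applied to \<open>inverse c\<close> it
  yields the reverse one.\<close>

lemma sublinearI:
  fixes p :: "'a::real_vector \<Rightarrow> real"
  assumes add: "\<And>x y. p (x + y) \<le> p x + p y"
    and scale: "\<And>c x. 0 < c \<Longrightarrow> p (c *\<^sub>R x) \<le> c * p x"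
    and zero: "p 0 = 0"
  shows "sublinear p"
proof -
  have "p (c *\<^sub>R x) = c * p x" if "0 < c" for c x
  proof (rule antisym)
    have "p (inverse c *\<^sub>R c *\<^sub>R x) \<le> inverse c * p (c *\<^sub>R x)"
      using that by (intro scale) simp
    then show "c * p x \<le> p (c *\<^sub>R x)"
      using that by (simp add: field_simps)
  qed (rule scale[OF that])
  then show ?thesis
    unfolding sublinear_def using add zero by (auto simp: le_less)
qed

text \<open>Supplies the lower bounds for Zorn's lemma. For subadditivity, the smaller of two
  members of the chain serves both arguments; \<open>b\<close> keeps the pointwise infima
  finite.\<close>

lemma sublinear_INF:
  fixes p :: "'a::real_vector \<Rightarrow> real"
  assumes "C \<noteq> {}" and sub: "\<And>q. q \<in> C \<Longrightarrow> sublinear q"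
    and lower: "\<And>q x. q \<in> C \<Longrightarrow> b x \<le> q x"
    and chain: "\<And>q r. q \<in> C \<Longrightarrow> r \<in> C \<Longrightarrow> q \<le> r \<or> r \<le> q"
  shows "sublinear (\<lambda>x. INF q\<in>C. q x)"
proof (rule sublinearI)
  have bdd: "bdd_below ((\<lambda>q. q x) ` C)" for x
    using lower by (intro bdd_belowI[of _ "b x"]) auto
  show "(INF q\<in>C. q (x + y)) \<le> (INF q\<in>C. q x) + (INF q\<in>C. q y)" for x y
  proof -
    have "(INF q\<in>C. q (x + y)) \<le> q x + r y" if qr: "q \<in> C" "r \<in> C" for q r
    proof -
      obtain s where s: "s \<in> C" "s \<le> q" "s \<le> r"
        using chain[OF qr] qr by blast
      have "(INF q\<in>C. q (x + y)) \<le> s (x + y)"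
        by (rule cINF_lower[OF bdd s(1)])
      also have "\<dots> \<le> s x + s y"
        by (rule sublinear_add[OF sub[OF s(1)]])
      also have "\<dots> \<le> q x + r y"
        using s by (intro add_mono) (auto simp: le_fun_def)
      finally show ?thesis .
    qed
    then have "(INF q\<in>C. q (x + y)) - q x \<le> (INF r\<in>C. r y)" if "q \<in> C" for q
      using that by (intro cINF_greatest[OF \<open>C \<noteq> {}\<close>]) (metis add.commute diff_le_eq)
    then have "(INF q\<in>C. q (x + y)) - (INF r\<in>C. r y) \<le> (INF q\<in>C. q x)"
      by (intro cINF_greatest[OF \<open>C \<noteq> {}\<close>]) (simp add: algebra_simps)
    then show ?thesis
      by simp
  qed
  show "(INF q\<in>C. q (c *\<^sub>R x)) \<le> c * (INF q\<in>C. q x)" if "0 < c" for c x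
  proof -
    have "(INF q\<in>C. q (c *\<^sub>R x)) / c \<le> q x" if "q \<in> C" for q
      using cINF_lower[OF bdd that, of "c *\<^sub>R x"] sublinear_scaleR[OF sub[OF that], of c x] \<open>0 < c\<close>
      by (simp add: field_simps)
    then have "(INF q\<in>C. q (c *\<^sub>R x)) / c \<le> (INF q\<in>C. q x)"
      by (intro cINF_greatest[OF \<open>C \<noteq> {}\<close>])
    then show ?thesis
      using that by (simp add: field_simps)
  qed
  have "(\<lambda>q. q 0) ` C = {0}"
    using \<open>C \<noteq> {}\<close> sublinear_zero[OF sub] by (force simp: image_iff)
  then show "(INF q\<in>C. q 0) = 0"
    by simp
qed

text \<open>Take the infimum over \<open>t \<ge> 0\<close> of
  \<open>p (x + t *\<^sub>R y) - t * p y\<close>: the value at \<open>t = 0\<close> gives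
  \<open>q \<le> p\<close>, the one at \<open>t = 1\<close> gives the bound at \<open>- y\<close>. A
  linear functional below \<open>q\<close> then agrees with \<open>p\<close> at
  \<open>y\<close>.\<close>

lemma sublinear_directional:
  fixes p :: "'a::real_vector \<Rightarrow> real"
  assumes p: "sublinear p"
  obtains q where "sublinear q" "q \<le> p" "q (- y) \<le> - p y"
proof
  define F where "F x t = p (x + t *\<^sub>R y) - t * p y" for x t
  define q where "q x = (INF t\<in>{0..}. F x t)" for x
  \<comment> \<open>Subadditivity on \<open>t *\<^sub>R y = (x + t *\<^sub>R y) + (- x)\<close>
    makes the infimum finite.\<close>
  have "- p (- x) \<le> F x t" if "0 \<le> t" for x t
    using sublinear_add[OF p, of "x + t *\<^sub>R y" "- x"] sublinear_scaleR[OF p that, of y]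
    by (simp add: F_def)
  then have bdd: "bdd_below (F x ` {0..})" for x
    by (intro bdd_belowI[of _ "- p (- x)"]) auto
  have le: "q x \<le> F x t" if "0 \<le> t" for x t
    unfolding q_def using that by (intro cINF_lower[OF bdd]) simp
  have ge: "b \<le> q x" if "\<And>t. 0 \<le> t \<Longrightarrow> b \<le> F x t" for b x
    unfolding q_def using that by (intro cINF_greatest) auto
  show "q \<le> p"
    using le[of 0] by (auto simp: le_fun_def F_def)
  show "q (- y) \<le> - p y"
    using le[of 1 "- y"] by (simp add: F_def sublinear_zero[OF p])
  show "sublinear q"
  proof (rule sublinearI)
    show "q (x + z) \<le> q x + q z" for x z
    proof -
      have "q (x + z) \<le> F x s + F z t" if "0 \<le> s" "0 \<le> t" for s t
      proof -
        have "q (x + z) \<le> F (x + z) (s + t)"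
          using that by (intro le) simp
        also have "\<dots> \<le> F x s + F z t"
          using sublinear_add[OF p, of "x + s *\<^sub>R y" "z + t *\<^sub>R y"]
          by (simp add: F_def algebra_simps)
        finally show ?thesis .
      qed
      then have "q (x + z) - F x s \<le> q z" if "0 \<le> s" for s
        using that by (intro ge) (metis add.commute diff_le_eq)
      then have "q (x + z) - q z \<le> q x"
        by (intro ge) (simp add: algebra_simps)
      then show ?thesis
        by simp
    qed
    show "q (c *\<^sub>R x) \<le> c * q x" if "0 < c" for c x
    proof -
      have "q (c *\<^sub>R x) / c \<le> F x t" if "0 \<le> t" for t
      proof -
        have "q (c *\<^sub>R x) \<le> F (c *\<^sub>R x) (c * t)"
          using that \<open>0 < c\<close> by (intro le) simp
        also have "\<dots> = c * F x t"
          using sublinear_scaleR[OF p, of c "x + t *\<^sub>R y"] \<open>0 < c\<close>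
          by (simp add: F_def algebra_simps)
        finally show ?thesis
          using \<open>0 < c\<close> by (simp add: field_simps)
      qed
      then have "q (c *\<^sub>R x) / c \<le> q x"
        by (rule ge)
      then show ?thesis
        using that by (simp add: field_simps)
    qed
    have "F 0 t = 0" if "0 \<le> t" for t
      using sublinear_scaleR[OF p that] by (simp add: F_def)
    then show "q 0 = 0"
      by (simp add: q_def)
  qed
qed

text \<open>A minimal sublinear functional is linear, since none of its directional modifications
  from \<open>sublinear_directional\<close> can be strictly smaller.\<close>

theorem Hahn_Banach_sublinear:
  fixes p :: "'a::real_vector \<Rightarrow> real"
  assumes p: "sublinear p"
  obtains f :: "'a \<Rightarrow> real" where "linear f" "\<And>x. f x \<le> p x"
proof -
  define A where "A = {q. sublinear q \<and> q \<le> p}"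
  have pA: "p \<in> A"
    using p by (simp add: A_def)
  \<comment> \<open>The order is reversed, so that Zorn's lemma yields a minimal element.\<close>
  have "\<exists>m\<in>A. \<forall>a\<in>A. a \<le> m \<longrightarrow> a = m"
  proof (rule predicate_Zorn[where P = "\<lambda>a b. b \<le> a"])
    show "partial_order_on A (relation_of (\<lambda>a b. b \<le> a) A)"
      by (rule partial_order_on_relation_ofI) auto
    fix C assume C: "C \<in> Chains (relation_of (\<lambda>a b. b \<le> a) A)"
    show "\<exists>u\<in>A. \<forall>a\<in>C. u \<le> a"
    proof (cases "C = {}")
      case True
      then show ?thesis
        using pA by auto
    next
      case False
      have CA: "q \<in> A" if "q \<in> C" for q
        using C that by (auto simp: Chains_def relation_of_def)
      have chain: "q \<le> r \<or> r \<le> q" if "q \<in> C" "r \<in> C" for q r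
        using C that by (auto simp: Chains_def relation_of_def)
      \<comment> \<open>Lying below \<open>p\<close> gives
        \<open>- p (- x) \<le> - q (- x) \<le> q x\<close>, a bound common to the whole
        chain.\<close>
      have lower: "- p (- x) \<le> q x" if "q \<in> C" for q x
      proof -
        have "q (- x) \<le> p (- x)" "sublinear q"
          using CA[OF that] by (auto simp: A_def le_fun_def)
        then show ?thesis
          using sublinear_uminus[of q x] by linarith
      qed
      define u where "u x = (INF q\<in>C. q x)" for x
      have u: "u \<le> q" if "q \<in> C" for q
        unfolding u_def le_fun_def using lower that
        by (auto intro!: cINF_lower bdd_belowI2)
      have "sublinear u"
        unfolding u_def
      proof (rule sublinear_INF)
        show "sublinear q" if "q \<in> C" for q
          using CA[OF that] by (simp add: A_def)
      qed (use False lower chain in auto)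
      moreover obtain q where "q \<in> C"
        using False by blast
      ultimately have "u \<in> A"
        using u[of q] CA[of q] by (auto simp: A_def)
      then show ?thesis
        using u by blast
    qed
  qed
  then obtain f where f: "sublinear f" "f \<le> p"
    and minimal: "\<And>a. sublinear a \<Longrightarrow> a \<le> f \<Longrightarrow> a = f"
    unfolding A_def by (auto intro: order_trans)
  have neg: "f (- y) = - f y" for y
  proof -
    obtain q where "sublinear q" "q \<le> f" "q (- y) \<le> - f y"
      using sublinear_directional[OF f(1)] .
    then have "f (- y) \<le> - f y"
      using minimal by blast
    then show ?thesis
      using sublinear_uminus[OF f(1), of y] by simp
  qed
  have "linear f"
  proof (rule linearI)
    \<comment> \<open>Subadditivity at \<open>- x\<close> and \<open>- y\<close> turns into
      superadditivity because \<open>f\<close> is odd.\<close>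
    show "f (x + y) = f x + f y" for x y
      using sublinear_add[OF f(1), of x y] sublinear_add[OF f(1), of "- x" "- y"] neg[of "x + y"]
      by (simp add: neg)
    show "f (c *\<^sub>R x) = c *\<^sub>R f x" for c x
    proof (cases "0 \<le> c")
      case False
      then show ?thesis
        using sublinear_scaleR[OF f(1), of "- c" x] neg[of "c *\<^sub>R x"] by simp
    qed (simp add: sublinear_scaleR[OF f(1)])
  qed
  then show ?thesis
    using f(2) that by (auto simp: le_fun_def)
qed

section \<open>Functionals of norm at most one: norming functionals and cluster points\<close>

lemma Hahn_Banach_le_norm:
  fixes p :: "'a::real_normed_vector \<Rightarrow> real"
  assumes "sublinear p" and le: "\<And>x. p x \<le> norm x"
  obtains f :: "'a dual" where "norm f \<le> 1" "\<And>x. blinfun_apply f x \<le> p x"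
proof -
  obtain f where f: "linear f" "\<And>x. f x \<le> p x"
    using Hahn_Banach_sublinear[OF assms(1)] by metis
  have abs: "\<bar>f x\<bar> \<le> norm x" for x
    using f(2)[of x] f(2)[of "- x"] le[of x] le[of "- x"] linear_neg[OF f(1), of x] by simp
  then have "bounded_linear f"
    using f(1) by (intro linear_conv_bounded_linear[THEN iffD1] bounded_linear_intro[of _ 1])
      (auto simp: linear_add linear_scale)
  then have "blinfun_apply (Blinfun f) = f"
    by (rule bounded_linear_Blinfun_apply)
  with f abs show ?thesis
    by (intro that[of "Blinfun f"] norm_blinfun_bound) auto
qed

lemma sublinear_norm: "sublinear (norm :: 'a::real_normed_vector \<Rightarrow> real)"
  by (simp add: sublinear_def norm_triangle_ineq)

lemma abs_blinfun_le:
  fixes f :: "'a::real_normed_vector dual"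
  assumes "norm f \<le> 1"
  shows "\<bar>blinfun_apply f x\<bar> \<le> norm x"
  using norm_blinfun[of f x] mult_right_mono[OF assms, of "norm x"] by simp

text \<open>The directional modification of the norm at \<open>y\<close> already forces every linear
  functional below it to take the value \<open>norm y\<close> at \<open>y\<close>.\<close>

lemma norming_functional:
  fixes y :: "'a::real_normed_vector"
  obtains f :: "'a dual" where "norm f \<le> 1" "blinfun_apply f y = norm y"
proof -
  obtain q where q: "sublinear q" "q \<le> norm" "q (- y) \<le> - norm y"
    using sublinear_directional[OF sublinear_norm] .
  obtain f :: "'a dual" where f: "norm f \<le> 1" "\<And>x. blinfun_apply f x \<le> q x"
    using Hahn_Banach_le_norm[OF q(1)] q(2) by (auto simp: le_fun_def)
  have "norm y \<le> blinfun_apply f y"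
    using f(2)[of "- y"] q(3) by (simp add: blinfun.minus_right)
  then show ?thesis
    using that[OF f(1)] abs_blinfun_le[OF f(1), of y] by simp
qed

text \<open>A weak-* cluster point of a bounded sequence of functionals, obtained from the Hahn--Banach
  theorem for the sublinear functional \<open>x \<mapsto> limsup h\<^sub>n x\<close> instead of compactness.\<close>

lemma bounded_functionals_cluster:
  fixes h :: "nat \<Rightarrow> 'a::real_normed_vector dual"
  assumes h: "\<And>n. norm (h n) \<le> 1"
  obtains f :: "'a dual" where "norm f \<le> 1"
    "\<And>x c. eventually (\<lambda>n. c \<le> blinfun_apply (h n) x) sequentially \<Longrightarrow> c \<le> blinfun_apply f x"
proof -
  \<comment> \<open>\<open>S x\<close> consists of the eventual upper bounds of
    \<open>h n x\<close>. It contains \<open>norm x\<close> and is bounded below by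
    \<open>- norm x\<close>, so its infimum \<open>p x\<close> is the limsup.\<close>
  define S where "S x = {c. eventually (\<lambda>n. blinfun_apply (h n) x \<le> c) sequentially}" for x
  define p where "p x = Inf (S x)" for x
  note bound = abs_blinfun_le[OF h]
  have normS: "norm x \<in> S x" for x
    using bound by (auto simp: S_def abs_le_iff)
  have lower: "- norm x \<le> c" if c: "c \<in> S x" for x c
  proof -
    obtain n where "blinfun_apply (h n) x \<le> c"
      using eventually_happens'[OF sequentially_bot] c by (auto simp: S_def)
    then show ?thesis
      using bound[of n x] by linarith
  qed
  have le: "p x \<le> c" if "c \<in> S x" for x c
    unfolding p_def using that lower by (intro cInf_lower bdd_belowI[of _ "- norm x"]) auto
  have ge: "b \<le> p x" if "\<And>c. c \<in> S x \<Longrightarrow> b \<le> c" for b x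
    unfolding p_def using that normS[of x] by (intro cInf_greatest) auto
  have "sublinear p"
  proof (rule sublinearI)
    show "p (x + y) \<le> p x + p y" for x y
    proof -
      have "p (x + y) \<le> c + d" if "c \<in> S x" "d \<in> S y" for c d
      proof (rule le)
        have "eventually (\<lambda>n. blinfun_apply (h n) x \<le> c \<and> blinfun_apply (h n) y \<le> d) sequentially"
          using that by (simp add: S_def eventually_conj)
        then show "c + d \<in> S (x + y)"
          unfolding S_def by (auto elim!: eventually_mono simp: blinfun.add_right)
      qed
      then have "p (x + y) - c \<le> p y" if "c \<in> S x" for c
        using that by (intro ge) (metis add.commute diff_le_eq)
      then have "p (x + y) - p y \<le> p x"
        by (intro ge) (simp add: algebra_simps)
      then show ?thesis
        by simp
    qed
    show "p (r *\<^sub>R x) \<le> r * p x" if "0 < r" for r x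
    proof -
      have "p (r *\<^sub>R x) / r \<le> c" if "c \<in> S x" for c
      proof -
        have "r * c \<in> S (r *\<^sub>R x)"
          using that \<open>0 < r\<close> unfolding S_def by (simp add: blinfun.scaleR_right)
        from le[OF this] show ?thesis
          using \<open>0 < r\<close> by (simp add: field_simps)
      qed
      then have "p (r *\<^sub>R x) / r \<le> p x"
        by (rule ge)
      then show ?thesis
        using that by (simp add: field_simps)
    qed
    show "p 0 = 0"
      using le[of 0 0] ge[of 0 0] normS[of 0] lower[of _ 0] by fastforce
  qed
  then obtain f :: "'a dual" where f: "norm f \<le> 1" "\<And>x. blinfun_apply f x \<le> p x"
    using Hahn_Banach_le_norm[of p] le[OF normS] by metis
  show ?thesis
  proof (rule that[OF f(1)])
    fix x c assume "eventually (\<lambda>n. c \<le> blinfun_apply (h n) x) sequentially"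
    then have "- c \<in> S (- x)"
      by (simp add: S_def blinfun.minus_right)
    from le[OF this] f(2)[of "- x"] show "c \<le> blinfun_apply f x"
      by (simp add: blinfun.minus_right)
  qed
qed

subsection \<open>Slices and Daugavet centers\<close>

lemma norm_blinfun_approx:
  fixes A :: "'a::real_normed_vector \<Rightarrow>\<^sub>L 'b::real_normed_vector"
  assumes "0 \<le> c" "c < norm A"
  obtains x where "norm x \<le> 1" "c < norm (blinfun_apply A x)"
proof -
  obtain x where x: "c * norm x < norm (blinfun_apply A x)"
    using norm_blinfun_bound[OF assms(1), of A] assms(2) by (meson not_le)
  then have "x \<noteq> 0"
    by auto
  with x show ?thesis
    by (intro that[of "x /\<^sub>R norm x"]) (auto simp: blinfun.scaleR_right field_simps)
qed

section \<open>Rank-one operators and contractions\<close>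

lemma rank_one_tensor:
  fixes g :: "'a::real_normed_vector dual" and z :: "'b::real_normed_vector"
  assumes "g \<noteq> 0" "z \<noteq> 0"
  shows "rank_one (blinfun_scaleR_left z o\<^sub>L g)"
proof -
  obtain x where x: "blinfun_apply g x \<noteq> 0"
    using assms(1) by (metis blinfun_eqI zero_blinfun.rep_eq)
  have "range (blinfun_apply (blinfun_scaleR_left z o\<^sub>L g)) = (\<lambda>c. c *\<^sub>R z) ` range (blinfun_apply g)"
    by auto
  also have "range (blinfun_apply g) = UNIV"
  proof (rule surjI)
    show "blinfun_apply g ((c / blinfun_apply g x) *\<^sub>R x) = c" for c
      using x by (simp add: blinfun.scaleR_right)
  qed
  also have "range (\<lambda>c. c *\<^sub>R z) = span {z}"
    by (simp add: span_singleton)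
  finally have "range (blinfun_apply (blinfun_scaleR_left z o\<^sub>L g)) = span {z}" .
  then show ?thesis
    using assms(2) unfolding rank_one_def by (simp add: dim_span_eq_card_independent del: dim_span)
qed

lemma norm_tensor:
  fixes g :: "'a::real_normed_vector dual" and z :: "'b::real_normed_vector"
  shows "norm (blinfun_scaleR_left z o\<^sub>L g) = norm g * norm z"
proof (rule antisym)
  show "norm (blinfun_scaleR_left z o\<^sub>L g) \<le> norm g * norm z"
  proof (rule norm_blinfun_bound)
    fix x show "norm (blinfun_apply (blinfun_scaleR_left z o\<^sub>L g) x) \<le> norm g * norm z * norm x"
      using mult_right_mono[OF norm_blinfun[of g x], of "norm z"] by (simp add: ac_simps)
  qed simp
  show "norm g * norm z \<le> norm (blinfun_scaleR_left z o\<^sub>L g)"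
  proof (cases "z = 0")
    case False
    have "norm g \<le> norm (blinfun_scaleR_left z o\<^sub>L g) / norm z"
    proof (rule norm_blinfun_bound)
      fix x show "norm (blinfun_apply g x) \<le> norm (blinfun_scaleR_left z o\<^sub>L g) / norm z * norm x"
        using norm_blinfun[of "blinfun_scaleR_left z o\<^sub>L g" x] False by (simp add: field_simps)
    qed simp
    then show ?thesis
      using False by (simp add: field_simps)
  qed simp
qed

lemma norm_comp_contraction_le:
  fixes f :: "'b::real_normed_vector dual" and G :: "'a::real_normed_vector \<Rightarrow>\<^sub>L 'b"
  assumes "norm f \<le> 1" "norm G \<le> 1"
  shows "norm (f o\<^sub>L G) \<le> 1"
  using norm_blinfun_compose[of f G] mult_mono[OF assms] by simp

lemma blinfun_ball_le:
  fixes A :: "'a::real_normed_vector \<Rightarrow>\<^sub>L 'b::real_normed_vector"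
  assumes "norm A \<le> 1" "norm x \<le> 1"
  shows "norm (blinfun_apply A x) \<le> 1"
  using norm_blinfun[of A x] mult_mono[OF assms] by simp

text \<open>The Daugavet equation for \<open>G\<close> plus the normalised tensor of
  \<open>g\<close> and \<open>z\<close> yields \<open>x\<close> and \<open>f\<close> with
  \<open>f (G x)\<close>, \<open>k x\<close> and \<open>f e\<close> all near \<open>1\<close>. Hence
  \<open>f o\<^sub>L G + k\<close> has norm near \<open>2\<close>, and wherever it is almost maximal
  on the ball both summands must be near \<open>1\<close>.\<close>

lemma daugavet_center_subslice:
  fixes G :: "'x::real_normed_vector \<Rightarrow>\<^sub>L 'y::real_normed_vector"
  assumes G: "daugavet_center G" "norm G = 1"
    and "g \<noteq> 0" "0 < \<delta>" "z \<noteq> 0" "0 < \<epsilon>"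
  obtains g' :: "'x dual" and \<delta>' and f :: "'y dual"
  where "g' \<noteq> 0" "0 < \<delta>'" "norm f \<le> 1" "norm z - \<epsilon> \<le> blinfun_apply f z"
    "\<And>x. norm x \<le> 1 \<Longrightarrow> norm g' - \<delta>' \<le> blinfun_apply g' x \<Longrightarrow>
      norm g - \<delta> \<le> blinfun_apply g x \<and> 1 - \<epsilon> \<le> blinfun_apply f (blinfun_apply G x)"
proof -
  \<comment> \<open>The bound \<open>1/2\<close> keeps the product below positive and
    \<open>g'\<close> nonzero; the two thirds absorb the loss \<open>3 * \<eta>\<close> on the new
    slice; the last bound pays for passing from \<open>e\<close> to \<open>z\<close>.\<close>
  define \<eta> where "\<eta> = min (min (1/2) (\<epsilon> / 3)) (min (\<delta> / (3 * norm g)) (\<epsilon> / norm z))"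
  have \<eta>: "0 < \<eta>"
    using assms by (simp add: \<eta>_def)
  have \<eta>': "\<eta> \<le> 1/2" "\<eta> \<le> \<epsilon> / 3" "\<eta> \<le> \<delta> / (3 * norm g)" "\<eta> \<le> \<epsilon> / norm z"
    unfolding \<eta>_def by linarith+
  have \<eta>g: "3 * \<eta> * norm g \<le> \<delta>" and \<eta>z: "\<eta> * norm z \<le> \<epsilon>"
    using \<eta>'(3,4) assms by (auto simp: field_simps)
  define k where "k = g /\<^sub>R norm g"
  define e where "e = z /\<^sub>R norm z"
  have k: "norm k = 1" "g = norm g *\<^sub>R k" and e: "norm e = 1" "z = norm z *\<^sub>R e"
    using assms by (auto simp: k_def e_def)
  define T where "T = blinfun_scaleR_left e o\<^sub>L k"
  have T: "rank_one T" "norm T = 1"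
    unfolding T_def using k e by (force intro!: rank_one_tensor, simp add: norm_tensor)
  then have "norm (G + T) = 2"
    using G by (simp add: daugavet_center_def)
  then obtain w where w: "norm w \<le> 1" "2 - \<eta> < norm (blinfun_apply (G + T) w)"
    using norm_blinfun_approx[of "2 - \<eta>" "G + T"] \<eta> \<eta>'(1) by auto
  \<comment> \<open>Changing the sign of \<open>w\<close> makes \<open>k w\<close> nonnegative, so that a functional norming
    \<open>(G + T) w\<close> is almost \<open>1\<close> at both \<open>G w\<close> and \<open>e\<close>.\<close>
  define x where "x = (if 0 \<le> blinfun_apply k w then w else - w)"
  have x: "norm x \<le> 1" "2 - \<eta> < norm (blinfun_apply (G + T) x)" "0 \<le> blinfun_apply k x"
    using w by (auto simp: x_def blinfun.minus_right)
  obtain f :: "'y dual" where f: "norm f \<le> 1"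
    "blinfun_apply f (blinfun_apply (G + T) x) = norm (blinfun_apply (G + T) x)"
    using norming_functional .
  have sum: "2 - \<eta> < blinfun_apply f (blinfun_apply G x) + blinfun_apply k x * blinfun_apply f e"
    using x(2) f(2) by (simp add: T_def blinfun.add_left blinfun.add_right blinfun.scaleR_right)
  have fG: "\<bar>blinfun_apply f (blinfun_apply G x)\<bar> \<le> 1" if "norm x \<le> 1" for x
    using blinfun_ball_le[OF norm_comp_contraction_le[OF f(1)] that, of G] G(2) by simp
  have kx: "\<bar>blinfun_apply k x\<bar> \<le> 1" if "norm x \<le> 1" for x
    using blinfun_ball_le[of k x] k that by simp
  have fe: "\<bar>blinfun_apply f e\<bar> \<le> 1"
    using blinfun_ball_le[OF f(1), of e] e by simp
  \<comment> \<open>The other summand is at most \<open>1\<close>. As neither factor exceeds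
    \<open>1\<close> and \<open>k x\<close> is nonnegative, each factor is itself above
    \<open>1 - \<eta>\<close>.\<close>
  have prod: "1 - \<eta> < blinfun_apply k x * blinfun_apply f e"
    using sum fG[OF x(1)] by simp
  then have "0 < blinfun_apply k x * blinfun_apply f e"
    using \<eta>'(1) by simp
  then have "0 < blinfun_apply f e"
    using x(3) by (simp add: zero_less_mult_iff)
  then have "blinfun_apply k x * blinfun_apply f e \<le> blinfun_apply k x"
    and "blinfun_apply k x * blinfun_apply f e \<le> blinfun_apply f e"
    using kx[OF x(1)] fe x(3) by (auto intro: mult_left_le mult_left_le_one_le)
  then have near: "1 - \<eta> < blinfun_apply k x" "1 - \<eta> < blinfun_apply f e"
    "1 - \<eta> < blinfun_apply f (blinfun_apply G x)"
    using prod sum kx[OF x(1)] fe by auto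
  define g' where "g' = (f o\<^sub>L G) + k"
  have "2 - 2 * \<eta> < blinfun_apply g' x"
    using near by (simp add: g'_def blinfun.add_left)
  also have "\<dots> \<le> norm g' * norm x"
    using norm_blinfun[of g' x] by simp
  also have "\<dots> \<le> norm g'"
    using x(1) by (simp add: mult_left_le)
  finally have g': "2 - 2 * \<eta> < norm g'" .
  show ?thesis
  proof (rule that[of g' \<eta> f])
    show "g' \<noteq> 0"
      using g' \<eta>'(1) by auto
    have "norm z * (1 - \<eta>) \<le> norm z * blinfun_apply f e"
      using near by (intro mult_left_mono) auto
    also have "\<dots> = blinfun_apply f z"
      using arg_cong[OF e(2), of "blinfun_apply f"] by (simp add: blinfun.scaleR_right)
    finally show "norm z - \<epsilon> \<le> blinfun_apply f z"
      using \<eta>z by (simp add: algebra_simps)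
    fix x' :: 'x assume x': "norm x' \<le> 1" "norm g' - \<eta> \<le> blinfun_apply g' x'"
    then have sum': "2 - 3 * \<eta> \<le> blinfun_apply f (blinfun_apply G x') + blinfun_apply k x'"
      using g' by (simp add: g'_def blinfun.add_left)
    then have "1 - 3 * \<eta> \<le> blinfun_apply k x'"
      using fG[OF x'(1)] by simp
    then have "norm g * (1 - 3 * \<eta>) \<le> norm g * blinfun_apply k x'"
      by (intro mult_left_mono) auto
    also have "\<dots> = blinfun_apply g x'"
      using arg_cong[OF k(2), of "\<lambda>l. blinfun_apply l x'"] by (simp add: blinfun.scaleR_left)
    finally show "norm g - \<delta> \<le> blinfun_apply g x' \<and> 1 - \<epsilon> \<le> blinfun_apply f (blinfun_apply G x')"
      using sum' kx[OF x'(1)] \<eta>'(2) \<eta>g by (simp add: algebra_simps)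
  qed (use \<eta> f in auto)
qed

text \<open>Test \<open>z + G x\<close> against the functional of the preceding lemma, splitting
  \<open>\<epsilon>\<close> evenly between its two estimates.\<close>

lemma daugavet_center_subslice_norm:
  fixes G :: "'x::real_normed_vector \<Rightarrow>\<^sub>L 'y::real_normed_vector"
  assumes G: "daugavet_center G" "norm G = 1"
    and g: "g \<noteq> 0" "0 < \<delta>" and "0 < \<epsilon>"
  obtains g' :: "'x dual" and \<delta>' where "g' \<noteq> 0" "0 < \<delta>'"
    "\<And>x. norm x \<le> 1 \<Longrightarrow> norm g' - \<delta>' \<le> blinfun_apply g' x \<Longrightarrow>
      norm g - \<delta> \<le> blinfun_apply g x \<and> norm z + 1 - \<epsilon> \<le> norm (z + blinfun_apply G x)"
proof -
  \<comment> \<open>The preceding lemma needs a nonzero vector; for \<open>z = 0\<close> an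
    arbitrary one stands in, since the estimate of \<open>f z\<close> is then trivial.\<close>
  obtain a where "blinfun_apply G a \<noteq> 0"
    using G(2) by (metis blinfun_eqI norm_zero zero_blinfun.rep_eq zero_neq_one)
  then obtain z' where z': "z' \<noteq> 0" "z \<noteq> 0 \<Longrightarrow> z' = z"
    by metis
  obtain g' :: "'x dual" and \<delta>' and f :: "'y dual"
    where g': "g' \<noteq> 0" "0 < \<delta>'" and f: "norm f \<le> 1" "norm z' - \<epsilon> / 2 \<le> blinfun_apply f z'"
      and slice: "\<And>x. norm x \<le> 1 \<Longrightarrow> norm g' - \<delta>' \<le> blinfun_apply g' x \<Longrightarrow>
        norm g - \<delta> \<le> blinfun_apply g x \<and> 1 - \<epsilon> / 2 \<le> blinfun_apply f (blinfun_apply G x)"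
    using daugavet_center_subslice[OF G g z'(1), of "\<epsilon> / 2"] \<open>0 < \<epsilon>\<close> by auto
  have fz: "norm z - \<epsilon> / 2 \<le> blinfun_apply f z"
    using f z' \<open>0 < \<epsilon>\<close> by (cases "z = 0") auto
  show ?thesis
  proof (rule that[OF g'])
    fix x assume x: "norm x \<le> 1" "norm g' - \<delta>' \<le> blinfun_apply g' x"
    have "blinfun_apply f (z + blinfun_apply G x) \<le> norm (z + blinfun_apply G x)"
      using abs_blinfun_le[OF f(1)] abs_le_D1 by blast
    then show "norm g - \<delta> \<le> blinfun_apply g x \<and> norm z + 1 - \<epsilon> \<le> norm (z + blinfun_apply G x)"
      using slice[OF x] fz by (simp add: blinfun.add_right)
  qed
qed

text \<open>Slices are nested, one for each \<open>z\<close>: points of a smaller slice stay in the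
  larger one, so earlier estimates persist with the same \<open>\<epsilon>\<close>.\<close>

lemma daugavet_center_subslice_finite:
  fixes G :: "'x::real_normed_vector \<Rightarrow>\<^sub>L 'y::real_normed_vector"
  assumes G: "daugavet_center G" "norm G = 1"
    and "finite Z" "g \<noteq> 0" "0 < \<delta>" "0 < \<epsilon>"
  shows "\<exists>(g' :: 'x dual) \<delta>'. g' \<noteq> 0 \<and> 0 < \<delta>' \<and>
    (\<forall>x. norm x \<le> 1 \<longrightarrow> norm g' - \<delta>' \<le> blinfun_apply g' x \<longrightarrow>
      norm g - \<delta> \<le> blinfun_apply g x \<and> (\<forall>z\<in>Z. norm z + 1 - \<epsilon> \<le> norm (z + blinfun_apply G x)))"
  using \<open>finite Z\<close>
proof (induction Z rule: finite_induct)
  case empty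
  show ?case
    using assms by auto
next
  case (insert z Z)
  then obtain g1 :: "'x dual" and \<delta>1 where 1: "g1 \<noteq> 0" "0 < \<delta>1"
    "\<And>x. norm x \<le> 1 \<Longrightarrow> norm g1 - \<delta>1 \<le> blinfun_apply g1 x \<Longrightarrow>
      norm g - \<delta> \<le> blinfun_apply g x \<and> (\<forall>z\<in>Z. norm z + 1 - \<epsilon> \<le> norm (z + blinfun_apply G x))"
    by blast
  obtain g2 :: "'x dual" and \<delta>2 where "g2 \<noteq> 0" "0 < \<delta>2"
    "\<And>x. norm x \<le> 1 \<Longrightarrow> norm g2 - \<delta>2 \<le> blinfun_apply g2 x \<Longrightarrow>
      norm g1 - \<delta>1 \<le> blinfun_apply g1 x \<and> norm z + 1 - \<epsilon> \<le> norm (z + blinfun_apply G x)"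
    using daugavet_center_subslice_norm[OF G 1(1,2) \<open>0 < \<epsilon>\<close>, of z] by metis
  with 1(3) show ?case
    by (intro exI[of _ g2] exI[of _ \<delta>2]) auto
qed

lemma daugavet_center_slice:
  fixes G :: "'x::real_normed_vector \<Rightarrow>\<^sub>L 'y::real_normed_vector" and g :: "'x dual"
  assumes G: "daugavet_center G" "norm G = 1"
    and "finite Z" "0 < \<delta>" "0 < \<epsilon>"
  obtains x where "norm x \<le> 1" "norm g - \<delta> \<le> blinfun_apply g x"
    "\<And>z. z \<in> Z \<Longrightarrow> norm z + 1 - \<epsilon> \<le> norm (z + blinfun_apply G x)"
proof -
  \<comment> \<open>For \<open>g = 0\<close> the slice condition holds on the whole ball, so any
    nonzero functional can start the nesting.\<close>
  have "\<exists>k :: 'x dual. k \<noteq> 0 \<and> (g \<noteq> 0 \<longrightarrow> k = g)"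
  proof (cases "g = 0")
    case True
    obtain a where "blinfun_apply G a \<noteq> 0"
      using G(2) by (metis blinfun_eqI norm_zero zero_blinfun.rep_eq zero_neq_one)
    then have "a \<noteq> 0"
      by auto
    obtain f :: "'x dual" where "blinfun_apply f a = norm a"
      using norming_functional by metis
    then have "f \<noteq> 0"
      using \<open>a \<noteq> 0\<close> by auto
    then show ?thesis
      using True by auto
  qed auto
  then obtain k :: "'x dual" where k: "k \<noteq> 0" "g \<noteq> 0 \<Longrightarrow> k = g"
    by auto
  obtain g' :: "'x dual" and \<delta>' where g': "g' \<noteq> 0" "0 < \<delta>'"
    "\<And>x. norm x \<le> 1 \<Longrightarrow> norm g' - \<delta>' \<le> blinfun_apply g' x \<Longrightarrow> norm k - \<delta> \<le> blinfun_apply k x \<and>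
      (\<forall>z\<in>Z. norm z + 1 - \<epsilon> \<le> norm (z + blinfun_apply G x))"
    using daugavet_center_subslice_finite[OF G assms(3) k(1) assms(4,5)] by blast
  \<comment> \<open>The maximum with \<open>0\<close> covers \<open>\<delta>'\<close> larger than
    \<open>norm g'\<close>; a change of sign then turns the absolute value into a value.\<close>
  obtain x where x: "norm x \<le> 1" "max 0 (norm g' - \<delta>') < norm (blinfun_apply g' x)"
    using norm_blinfun_approx[of "max 0 (norm g' - \<delta>')" g'] g' by auto
  define s where "s = (if 0 \<le> blinfun_apply g' x then x else - x)"
  have s: "norm s \<le> 1" "norm g' - \<delta>' \<le> blinfun_apply g' s"
    using x by (auto simp: s_def blinfun.minus_right)
  show ?thesis
    using g'(3)[OF s] k s(1) \<open>0 < \<delta>\<close> by (intro that[of s]) (cases "g = 0"; auto)+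
qed

subsection \<open>Steered averages\<close>

text \<open>This is \<open>n\<close> times the error of the \<open>n\<close>-th average at
  \<open>g i\<close>; unnormalised, it changes by a single summand when a point is added.\<close>

definition discrepancy ::
    "'x::real_normed_vector bidual \<Rightarrow> (nat \<Rightarrow> 'x dual) \<Rightarrow> (nat \<Rightarrow> 'x) \<Rightarrow> nat \<Rightarrow> nat \<Rightarrow> real"
  where "discrepancy u g x n i =
    (\<Sum>l<n. blinfun_apply u (g i) - blinfun_apply (g i) (x l))"

text \<open>Half the gradient, pulled back to the dual, of the energy
  \<open>\<Sum>i. (1/2)^i * (discrepancy u g x n i)\<^sup>2\<close>: a new point at which it is almost
  maximal increases the energy by at most a constant, so that the discrepancies are \<open>O(sqrt n)\<close>.\<close>

definition steering ::
    "'x::real_normed_vector bidual \<Rightarrow> (nat \<Rightarrow> 'x dual) \<Rightarrow> (nat \<Rightarrow> 'x) \<Rightarrow> nat \<Rightarrow> 'x dual"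
  where "steering u g x n = (\<Sum>i. ((1/2)^i * discrepancy u g x n i) *\<^sub>R g i)"

lemma abs_discrepancy_le:
  assumes "norm u \<le> 1" "norm (g i) \<le> 1" "\<And>l. norm (x l) \<le> 1"
  shows "\<bar>discrepancy u g x n i\<bar> \<le> 2 * real n"
proof -
  have "\<bar>blinfun_apply u (g i) - blinfun_apply (g i) (x l)\<bar> \<le> 2" for l
    using blinfun_ball_le[OF assms(1,2)] blinfun_ball_le[OF assms(2,3), of l] by simp
  then have "(\<Sum>l<n. \<bar>blinfun_apply u (g i) - blinfun_apply (g i) (x l)\<bar>) \<le> (\<Sum>l<n. 2)"
    by (intro sum_mono)
  then show ?thesis
    unfolding discrepancy_def by (intro order_trans[OF sum_abs]) simp
qed

lemma summable_half_power_mult: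
  fixes c :: "nat \<Rightarrow> real"
  assumes "\<And>i. \<bar>c i\<bar> \<le> C"
  shows "summable (\<lambda>i. (1/2)^i * c i)"
proof (rule summable_comparison_test)
  show "summable (\<lambda>i. C * (1/2::real)^i)"
    by (intro summable_mult summable_geometric) simp
  show "\<exists>N. \<forall>n\<ge>N. norm ((1/2)^n * c n) \<le> C * (1/2)^n"
    using assms by (intro exI[of _ 0]) (auto simp: abs_mult mult_right_mono)
qed

text \<open>The energy grows at most linearly in \<open>n\<close>, so each fixed discrepancy is
  \<open>O(sqrt n)\<close> and vanishes after division by \<open>n\<close>.\<close>

lemma averages_tendsto_of_steering:
  fixes u :: "'x::real_normed_vector bidual"
  assumes u: "norm u \<le> 1" and g: "\<And>i. norm (g i) \<le> 1" and x: "\<And>n. norm (x n) \<le> 1"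
    and steer: "\<And>n. blinfun_apply u (steering u g x n) - 1 \<le> blinfun_apply (steering u g x n) (x n)"
  shows "(\<lambda>n. (\<Sum>l<n. blinfun_apply (g i) (x l)) / real n) \<longlonglongrightarrow> blinfun_apply u (g i)"
proof -
  let ?d = "discrepancy u g x"
  note d = abs_discrepancy_le[of u g _ x, OF u g x]
  have sq: "r\<^sup>2 \<le> c\<^sup>2" if "\<bar>r\<bar> \<le> c" for r c :: real
    using power_mono[OF that, of 2] by simp
  define E where "E n = (\<Sum>i. (1/2)^i * (?d n i)\<^sup>2)" for n
  have summable_E: "summable (\<lambda>i. (1/2)^i * (?d n i)\<^sup>2)" for n
    using sq[OF d] by (intro summable_half_power_mult[of _ "(2 * real n)\<^sup>2"]) simp
  \<comment> \<open>\<open>10 = 2 + 8\<close>: the cross term is at most \<open>2\<close> by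
    \<open>steer\<close>, and the squares \<open>(a i)\<^sup>2 \<le> 4\<close> carry weights of
    total mass \<open>2\<close>.\<close>
  have step: "E (Suc n) \<le> E n + 10" for n
  proof -
    let ?\<gamma> = "steering u g x n"
    define a where "a i = blinfun_apply u (g i) - blinfun_apply (g i) (x n)" for i
    have a: "\<bar>a i\<bar> \<le> 2" for i
      using blinfun_ball_le[OF u g, of i] blinfun_ball_le[OF g x, of i n] by (simp add: a_def)
    have "norm (((1/2)^i * ?d n i) *\<^sub>R g i) \<le> (2 * real n) * (1/2)^i" for i
      using mult_mono[OF d[of n i] g[of i]] by (simp add: abs_mult divide_simps)
    moreover have "summable (\<lambda>i. (2 * real n) * (1/2)^i)"
      by (intro summable_mult summable_geometric) simp
    ultimately have "summable (\<lambda>i. ((1/2)^i * ?d n i) *\<^sub>R g i)"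
      by (rule summable_comparison_test'[rotated])
    then have \<gamma>: "(\<lambda>i. ((1/2)^i * ?d n i) *\<^sub>R g i) sums ?\<gamma>"
      unfolding steering_def by (rule summable_sums)
    \<comment> \<open>Continuity of \<open>u\<close> and of evaluation at \<open>x n\<close> moves
      both inside the series, so the cross term is exactly the gap controlled by
      \<open>steer\<close>.\<close>
    have "(\<lambda>i. (1/2)^i * ?d n i * a i) sums (blinfun_apply u ?\<gamma> - blinfun_apply ?\<gamma> (x n))"
      using sums_diff[OF bounded_linear.sums[OF blinfun.bounded_linear_right \<gamma>]
          bounded_linear.sums[OF blinfun.bounded_linear_left \<gamma>], of u "x n"]
      by (simp add: a_def blinfun.scaleR_right blinfun.scaleR_left algebra_simps)
    moreover have summable_a: "summable (\<lambda>i. (1/2)^i * (a i)\<^sup>2)"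
      using sq[OF a] by (intro summable_half_power_mult[of _ 4]) simp
    ultimately have "(\<lambda>i. (1/2)^i * (?d n i)\<^sup>2 + 2 * ((1/2)^i * ?d n i * a i) + (1/2)^i * (a i)\<^sup>2)
        sums (E n + 2 * (blinfun_apply u ?\<gamma> - blinfun_apply ?\<gamma> (x n)) + (\<Sum>i. (1/2)^i * (a i)\<^sup>2))"
      using summable_E[of n] unfolding E_def by (intro sums_add sums_mult summable_sums)
    moreover have "?d (Suc n) i = ?d n i + a i" for i
      by (simp add: discrepancy_def a_def)
    ultimately have "E (Suc n) =
        E n + 2 * (blinfun_apply u ?\<gamma> - blinfun_apply ?\<gamma> (x n)) + (\<Sum>i. (1/2)^i * (a i)\<^sup>2)"
      unfolding E_def[of "Suc n"]
      by (intro sums_unique[symmetric]) (simp add: power2_sum algebra_simps)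
    moreover have "(\<Sum>i. (1/2)^i * (a i)\<^sup>2) \<le> (\<Sum>i. (1/2)^i * 4)"
      using sq[OF a] summable_a summable_half_power_mult[of "\<lambda>_. 4" 4] by (intro suminf_le) auto
    moreover have "(\<Sum>i. (1/2::real)^i * 4) = 8"
      by (subst suminf_mult2[symmetric]) (auto simp: suminf_geometric summable_geometric)
    ultimately show ?thesis
      using steer[of n] by simp
  qed
  have E: "E n \<le> 10 * real n" for n
  proof (induction n)
    case 0
    show ?case
      by (simp add: E_def discrepancy_def)
  next
    case (Suc n)
    then show ?case
      using step[of n] by simp
  qed
  have bound: "(?d n i / real n)\<^sup>2 \<le> 10 * 2^i * (1 / real n)" for n
  proof (cases "n = 0")
    case False
    have "(1/2)^i * (?d n i)\<^sup>2 \<le> E n"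
      using sum_le_suminf[OF summable_E, of "{i}" n] by (simp add: E_def)
    also have "\<dots> \<le> 10 * real n"
      by (rule E)
    finally show ?thesis
      using False by (simp add: field_simps power2_eq_square)
  qed simp
  have "(\<lambda>n. (?d n i / real n)\<^sup>2) \<longlonglongrightarrow> 0"
  proof (rule tendsto_sandwich[where f = "\<lambda>_. 0"])
    show "(\<lambda>n. 10 * 2^i * (1 / real n)) \<longlonglongrightarrow> 0"
      using tendsto_mult_right_zero[OF lim_1_over_n] by blast
  qed (use bound in auto)
  then have "(\<lambda>n. sqrt ((?d n i / real n)\<^sup>2)) \<longlonglongrightarrow> 0"
    using tendsto_real_sqrt by fastforce
  then have "(\<lambda>n. ?d n i / real n) \<longlonglongrightarrow> 0"
    unfolding real_sqrt_abs by (rule tendsto_rabs_zero_cancel)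
  then have "(\<lambda>n. blinfun_apply u (g i) - ?d n i / real n) \<longlonglongrightarrow> blinfun_apply u (g i) - 0"
    by (intro tendsto_diff tendsto_const)
  moreover have "eventually (\<lambda>n. blinfun_apply u (g i) - ?d n i / real n =
      (\<Sum>l<n. blinfun_apply (g i) (x l)) / real n) sequentially"
    using eventually_gt_at_top[of 0]
    by eventually_elim (simp add: discrepancy_def sum_subtractf field_simps)
  ultimately show ?thesis
    by (simp add: tendsto_cong)
qed

section \<open>Choosing the sequence and norming its partial sums\<close>

text \<open>Stage \<open>n\<close> applies the slice lemma to the steering functional and to the
  finitely many partial sums begun at some \<open>m \<le> n\<close>; the one with
  \<open>m = n\<close> is just \<open>y n\<close>.\<close>

lemma daugavet_center_sequence:
  fixes G :: "'x::real_normed_vector \<Rightarrow>\<^sub>L 'y::real_normed_vector" and y :: "nat \<Rightarrow> 'y"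
  assumes G: "daugavet_center G" "norm G = 1" and u: "norm u \<le> 1"
  obtains x where "\<And>n. norm (x n) \<le> 1"
    "\<And>n. blinfun_apply u (steering u g x n) - 1 \<le> blinfun_apply (steering u g x n) (x n)"
    "\<And>m n. m \<le> n \<Longrightarrow> norm (y m + (\<Sum>l=m..<n. blinfun_apply G (x l))) + 1 - (1/2)^n \<le>
      norm (y m + (\<Sum>l=m..<Suc n. blinfun_apply G (x l)))"
proof -
  define z where "z x n m = y m + (\<Sum>l=m..<n. blinfun_apply G (x l))" for x n m
  define P where "P x n r \<longleftrightarrow> norm r \<le> 1 \<and>
    blinfun_apply u (steering u g x n) - 1 \<le> blinfun_apply (steering u g x n) r \<and>
    (\<forall>m\<le>n. norm (z x n m) + 1 - (1/2)^n \<le> norm (z x n m + blinfun_apply G r))" for x n r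
  \<comment> \<open>\<open>P x n r\<close> looks only at the values of \<open>x\<close> below
    \<open>n\<close>, so the points can be chosen recursively.\<close>
  have "\<exists>x. \<forall>n. P x n (x n)"
  proof (rule dependent_wellorder_choice)
    fix r and x x' :: "nat \<Rightarrow> 'x" and n
    assume eq: "\<And>l. l < n \<Longrightarrow> x l = x' l"
    have "discrepancy u g x n = discrepancy u g x' n" "z x n = z x' n"
      using eq by (auto simp: discrepancy_def z_def fun_eq_iff)
    then show "P x n r = P x' n r"
      by (simp add: P_def steering_def)
  next
    fix n and x :: "nat \<Rightarrow> 'x"
    let ?\<gamma> = "steering u g x n"
    obtain r where r: "norm r \<le> 1" "norm ?\<gamma> - 1 \<le> blinfun_apply ?\<gamma> r"
      "\<And>w. w \<in> z x n ` {..n} \<Longrightarrow> norm w + 1 - (1/2)^n \<le> norm (w + blinfun_apply G r)"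
      using daugavet_center_slice[OF G, of "z x n ` {..n}" 1 "(1/2)^n" ?\<gamma>] by auto
    moreover have "blinfun_apply u ?\<gamma> \<le> norm ?\<gamma>"
      using abs_blinfun_le[OF u, of ?\<gamma>] by simp
    ultimately show "\<exists>r. P x n r"
      unfolding P_def by (intro exI[of _ r]) auto
  qed
  then obtain x where "\<And>n. P x n (x n)"
    by blast
  then show ?thesis
    by (intro that[of x]) (auto simp: P_def z_def add.assoc)
qed

text \<open>The losses from stage \<open>m\<close> on add up to at most \<open>2 * (1/2)^m\<close>.
  In a sum normed by \<open>h n\<close> no term exceeds its maximal value, so no single term falls
  short by more than the total loss; a cluster point of the \<open>h n\<close> inherits
  this.\<close>

lemma uniform_norming_functional:
  fixes y :: "'y::real_normed_vector" and w :: "nat \<Rightarrow> 'y"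
  assumes w: "\<And>n. norm (w n) \<le> 1"
    and step: "\<And>n. m \<le> n \<Longrightarrow>
      norm (y + (\<Sum>l=m..<n. w l)) + 1 - (1/2)^n \<le> norm (y + (\<Sum>l=m..<Suc n. w l))"
  obtains f :: "'y dual" where "norm f \<le> 1" "norm y - 2 * (1/2)^m \<le> blinfun_apply f y"
    "\<And>j. m \<le> j \<Longrightarrow> 1 - 2 * (1/2)^m \<le> blinfun_apply f (w j)"
proof -
  let ?\<epsilon> = "2 * (1/2)^m :: real"
  \<comment> \<open>The extra \<open>2 * (1/2)^n\<close> is the loss still to come; each step spends
    half of it.\<close>
  have lower: "norm y + real (n - m) - ?\<epsilon> + 2 * (1/2)^n \<le> norm (y + (\<Sum>l=m..<n. w l))"
    if "m \<le> n" for n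
    using that
  proof (induction n rule: dec_induct)
    case (step n)
    then show ?case
      using assms(2)[of n] by (simp add: Suc_diff_le)
  qed simp
  have "\<exists>f :: 'y dual. norm f \<le> 1 \<and>
      blinfun_apply f (y + (\<Sum>l=m..<n. w l)) = norm (y + (\<Sum>l=m..<n. w l))" for n
    using norming_functional by metis
  then obtain h :: "nat \<Rightarrow> 'y dual" where h: "\<And>n. norm (h n) \<le> 1"
    "\<And>n. blinfun_apply (h n) (y + (\<Sum>l=m..<n. w l)) = norm (y + (\<Sum>l=m..<n. w l))"
    by metis
  have sum: "norm y + real (n - m) - ?\<epsilon> \<le>
      blinfun_apply (h n) y + (\<Sum>l=m..<n. blinfun_apply (h n) (w l))" if "m \<le> n" for n
  proof -
    have "0 \<le> 2 * (1/2::real)^n"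
      by simp
    then show ?thesis
      using h(2)[of n] lower[OF that] unfolding blinfun.add_right blinfun.sum_right by linarith
  qed
  have hw: "blinfun_apply (h n) (w l) \<le> 1" for n l
    using blinfun_ball_le[OF h(1) w, of n l] by simp
  obtain f :: "'y dual" where f: "norm f \<le> 1"
    "\<And>x c. eventually (\<lambda>n. c \<le> blinfun_apply (h n) x) sequentially \<Longrightarrow> c \<le> blinfun_apply f x"
    using bounded_functionals_cluster[of h, OF h(1)] by blast
  show ?thesis
  proof (rule that[OF f(1)])
    have "norm y - ?\<epsilon> \<le> blinfun_apply (h n) y" if "m \<le> n" for n
      using sum[OF that] sum_bounded_above[of "{m..<n}" "\<lambda>l. blinfun_apply (h n) (w l)" 1] hw
      by simp
    then show "norm y - ?\<epsilon> \<le> blinfun_apply f y"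
      by (intro f(2) eventually_sequentiallyI)
    fix j assume "m \<le> j"
    \<comment> \<open>Only from \<open>n = Suc j\<close> on does the sum contain index
      \<open>j\<close>; the other \<open>n - m - 1\<close> terms are at most \<open>1\<close>
      each.\<close>
    have "1 - ?\<epsilon> \<le> blinfun_apply (h n) (w j)" if "Suc j \<le> n" for n
    proof -
      have "(\<Sum>l=m..<n. blinfun_apply (h n) (w l)) = blinfun_apply (h n) (w j) +
          (\<Sum>l\<in>{m..<n} - {j}. blinfun_apply (h n) (w l))"
        using that \<open>m \<le> j\<close> by (intro sum.remove) auto
      moreover have "(\<Sum>l\<in>{m..<n} - {j}. blinfun_apply (h n) (w l)) \<le> real (n - m) - 1"
        using sum_bounded_above[of "{m..<n} - {j}" "\<lambda>l. blinfun_apply (h n) (w l)" 1] hw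
          that \<open>m \<le> j\<close> by (simp add: of_nat_diff)
      moreover have "blinfun_apply (h n) y \<le> norm y"
        using abs_blinfun_le[OF h(1), of n y] by simp
      ultimately show ?thesis
        using sum[of n] that \<open>m \<le> j\<close> by simp
    qed
    then show "1 - ?\<epsilon> \<le> blinfun_apply f (w j)"
      by (intro f(2) eventually_sequentiallyI)
  qed
qed

text \<open>The first \<open>m\<close> terms contribute \<open>K / n\<close> to the average of
  \<open>a l - c\<close>, which tends to \<open>0\<close>.\<close>

lemma eventually_average_ge:
  fixes a :: "nat \<Rightarrow> real"
  assumes "\<And>l. m \<le> l \<Longrightarrow> c \<le> a l" "0 < \<delta>"
  shows "eventually (\<lambda>n. c - \<delta> \<le> (\<Sum>l<n. a l) / real n) sequentially"
proof -
  define K where "K = (\<Sum>l<m. a l - c)"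
  have "(\<lambda>n. K / real n) \<longlonglongrightarrow> 0"
    by (rule lim_const_over_n)
  then have "eventually (\<lambda>n. - \<delta> < K / real n) sequentially"
    using assms(2) by (intro order_tendstoD) auto
  then show ?thesis
    using eventually_ge_at_top[of m] eventually_gt_at_top[of 0]
  proof eventually_elim
    case (elim n)
    have "K \<le> (\<Sum>l<m. a l - c) + (\<Sum>l=m..<n. a l - c)"
      using sum_nonneg[of "{m..<n}" "\<lambda>l. a l - c"] assms(1) by (simp add: K_def)
    also have "\<dots> = (\<Sum>l<n. a l - c)"
      using sum.atLeastLessThan_concat[of 0 m n "\<lambda>l. a l - c"] elim
      by (simp add: atLeast0LessThan)
    also have "\<dots> = (\<Sum>l<n. a l) - real n * c"
      by (simp add: sum_subtractf)
    finally show ?case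
      using elim divide_right_mono[of K "(\<Sum>l<n. a l) - real n * c" "real n"]
      by (simp add: diff_divide_distrib)
  qed
qed

section \<open>The bidual: canonical embedding, biadjoint and the cluster point
  \<open>v\<close>\<close>

lemma norm_canonical_embedding_le: "norm (canonical_embedding x) \<le> norm x"
proof (rule norm_blinfun_bound)
  show "norm (blinfun_apply (canonical_embedding x) f) \<le> norm x * norm f" for f
    using norm_blinfun[of f x] by (simp add: canonical_embedding.rep_eq mult.commute)
qed simp

lemma canonical_embedding_diff:
  "canonical_embedding (x - y) = canonical_embedding x - canonical_embedding y"
  by (rule blinfun_eqI) (simp add: canonical_embedding.rep_eq blinfun.diff_left blinfun.diff_right)

lemma biadjoint_apply: "blinfun_apply (blinfun_apply (biadjoint G) v) f = blinfun_apply v (f o\<^sub>L G)"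
  by (simp add: biadjoint_def dual_adjoint.rep_eq)

lemma norm_biadjoint_apply_le:
  fixes G :: "'a::real_normed_vector \<Rightarrow>\<^sub>L 'b::real_normed_vector"
  assumes "norm G \<le> 1" "norm v \<le> 1"
  shows "norm (blinfun_apply (biadjoint G) v) \<le> 1"
proof (rule norm_blinfun_bound)
  fix f :: "'b dual"
  have "norm (f o\<^sub>L G) \<le> norm f"
    using norm_blinfun_compose[of f G] mult_left_mono[OF assms(1), of "norm f"] by simp
  then show "norm (blinfun_apply (blinfun_apply (biadjoint G) v) f) \<le> 1 * norm f"
    using abs_blinfun_le[OF assms(2), of "f o\<^sub>L G"] by (simp add: biadjoint_apply)
qed simp

text \<open>Asking only \<open>norm (g n) \<le> 1\<close> admits zero among the \<open>g n\<close>,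
  which the claim on weak-* open sets uses.\<close>

lemma daugavet_center_L_orthogonal:
  fixes G :: "'x::real_normed_vector \<Rightarrow>\<^sub>L 'y::real_normed_vector"
    and g :: "nat \<Rightarrow> 'x dual"
  assumes G: "daugavet_center G" "norm G = 1"
    and separable: "separable_space (euclidean :: 'y topology)"
    and u: "norm u \<le> 1" and g: "\<And>n. norm (g n) \<le> 1"
  obtains v where "norm v = 1" "\<And>n. blinfun_apply v (g n) = blinfun_apply u (g n)"
    "\<And>y. norm (blinfun_apply (biadjoint G) v + canonical_embedding y) = 1 + norm y"
proof -
  obtain D :: "'y set" where D: "countable D" "closure D = UNIV"
    using separable by (auto simp: separable_space_def)
  then have "D \<noteq> {}"
    by auto
  define e where "e = from_nat_into D"
  have e: "range e = D"
    using D(1) \<open>D \<noteq> {}\<close> by (simp add: e_def range_from_nat_into)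
  \<comment> \<open>Each \<open>e k\<close> is repeated at arbitrarily large indices, where the losses are small.\<close>
  define y where "y m = e (fst (prod_decode m))" for m
  obtain x where x: "\<And>n. norm (x n) \<le> 1"
    and steer: "\<And>n. blinfun_apply u (steering u g x n) - 1 \<le> blinfun_apply (steering u g x n) (x n)"
    and growth: "\<And>m n. m \<le> n \<Longrightarrow> norm (y m + (\<Sum>l=m..<n. blinfun_apply G (x l))) + 1 - (1/2)^n \<le>
      norm (y m + (\<Sum>l=m..<Suc n. blinfun_apply G (x l)))"
    using daugavet_center_sequence[OF G u] by metis
  define h where "h n = canonical_embedding ((\<Sum>l<n. x l) /\<^sub>R real n)" for n
  have h_apply: "blinfun_apply (h n) f = (\<Sum>l<n. blinfun_apply f (x l)) / real n" for n f
    by (simp add: h_def canonical_embedding.rep_eq blinfun.scaleR_right blinfun.sum_right field_simps)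
  have h: "norm (h n) \<le> 1" for n
  proof -
    have "norm (\<Sum>l<n. x l) \<le> real n"
      using sum_norm_le[of "{..<n}" x "\<lambda>_. 1"] x by simp
    then have "norm ((\<Sum>l<n. x l) /\<^sub>R real n) \<le> 1"
      by (cases "n = 0") (auto simp: field_simps)
    then show ?thesis
      unfolding h_def using norm_canonical_embedding_le order_trans by blast
  qed
  obtain v where v: "norm v \<le> 1"
    and cluster: "\<And>f c. eventually (\<lambda>n. c \<le> blinfun_apply (h n) f) sequentially \<Longrightarrow> c \<le> blinfun_apply v f"
    using bounded_functionals_cluster[of h, OF h] by blast
  have limit: "L \<le> blinfun_apply v f" if "(\<lambda>n. blinfun_apply (h n) f) \<longlonglongrightarrow> L" for f L
  proof (rule field_le_epsilon)
    fix \<delta> :: real assume "0 < \<delta>"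
    then have "eventually (\<lambda>n. L - \<delta> < blinfun_apply (h n) f) sequentially"
      by (intro order_tendstoD(1)[OF that]) simp
    then have "L - \<delta> \<le> blinfun_apply v f"
      by (intro cluster) (auto elim: eventually_mono)
    then show "L \<le> blinfun_apply v f + \<delta>"
      by simp
  qed
  have vg: "blinfun_apply v (g i) = blinfun_apply u (g i)" for i
  proof -
    have lim: "(\<lambda>n. blinfun_apply (h n) (g i)) \<longlonglongrightarrow> blinfun_apply u (g i)"
      using averages_tendsto_of_steering[OF u g x steer] by (simp add: h_apply)
    \<comment> \<open>\<open>limit\<close> gives lower bounds only; applied to \<open>- g i\<close>
      it supplies the upper one.\<close>
    from tendsto_minus[OF this] have "(\<lambda>n. blinfun_apply (h n) (- g i)) \<longlonglongrightarrow> - blinfun_apply u (g i)"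
      by (simp add: blinfun.minus_right)
    from limit[OF lim] limit[OF this] show ?thesis
      by (simp add: blinfun.minus_right)
  qed
  let ?A = "blinfun_apply (biadjoint G) v"
  have Gx: "norm (blinfun_apply G (x n)) \<le> 1" for n
    using blinfun_ball_le[of G "x n"] G(2) x by simp
  \<comment> \<open>The functional \<open>f\<close> loses \<open>2 * (1/2)^m\<close> at
    \<open>y m\<close> and as much at \<open>?A\<close>; the points before \<open>m\<close>
    disappear in the averages.\<close>
  have lower_y: "1 + norm (y m) - 4 * (1/2)^m \<le> norm (?A + canonical_embedding (y m))" for m
  proof -
    obtain f :: "'y dual" where f: "norm f \<le> 1" "norm (y m) - 2 * (1/2)^m \<le> blinfun_apply f (y m)"
      "\<And>j. m \<le> j \<Longrightarrow> 1 - 2 * (1/2)^m \<le> blinfun_apply f (blinfun_apply G (x j))"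
      using uniform_norming_functional[of "\<lambda>n. blinfun_apply G (x n)" m "y m", OF Gx growth] by metis
    have "1 - 2 * (1/2)^m \<le> blinfun_apply v (f o\<^sub>L G)"
    proof (rule field_le_epsilon)
      fix \<delta> :: real assume "0 < \<delta>"
      then have "1 - 2 * (1/2)^m - \<delta> \<le> blinfun_apply v (f o\<^sub>L G)"
        by (intro cluster, unfold h_apply, intro eventually_average_ge[where m = m])
          (auto intro: f(3))
      then show "1 - 2 * (1/2)^m \<le> blinfun_apply v (f o\<^sub>L G) + \<delta>"
        by simp
    qed
    then have "1 + norm (y m) - 4 * (1/2)^m \<le> blinfun_apply (?A + canonical_embedding (y m)) f"
      using f(2) by (simp add: blinfun.add_left biadjoint_apply canonical_embedding.rep_eq)
    also have "\<dots> \<le> norm (?A + canonical_embedding (y m)) * norm f"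
      using norm_blinfun[of "?A + canonical_embedding (y m)" f] by simp
    also have "\<dots> \<le> norm (?A + canonical_embedding (y m))"
      using f(1) by (simp add: mult_left_le)
    finally show ?thesis .
  qed
  \<comment> \<open>\<open>e k\<close> occurs at index \<open>prod_encode (k, M) \<ge> M\<close> for
    every \<open>M\<close>, so the loss can be made arbitrarily small.\<close>
  have lower_e: "1 + norm (e k) \<le> norm (?A + canonical_embedding (e k))" for k
  proof -
    have "1 + norm (e k) - 4 * (1/2)^M \<le> norm (?A + canonical_embedding (e k))" for M
    proof -
      have "(1/2::real) ^ prod_encode (k, M) \<le> (1/2) ^ M"
        using le_prod_encode_2 by (intro power_decreasing) auto
      then show ?thesis
        using lower_y[of "prod_encode (k, M)"]
        unfolding y_def prod_encode_inverse fst_conv by linarith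
    qed
    moreover have "(\<lambda>M. 1 + norm (e k) - 4 * (1/2)^M) \<longlonglongrightarrow> 1 + norm (e k) - 4 * 0"
      by (intro tendsto_intros LIMSEQ_power_zero) simp
    ultimately show ?thesis
      using LIMSEQ_le_const2 by fastforce
  qed
  \<comment> \<open>Both sides are 1-Lipschitz in \<open>w\<close>, so approximation within
    \<open>\<delta> / 2\<close> costs at most \<open>\<delta>\<close>.\<close>
  have lower: "1 + norm w \<le> norm (?A + canonical_embedding w)" for w
  proof (rule field_le_epsilon)
    fix \<delta> :: real assume "0 < \<delta>"
    have "w \<in> closure (range e)"
      by (simp add: e D(2))
    then obtain k where k: "dist (e k) w < \<delta> / 2"
      using \<open>0 < \<delta>\<close> closure_approachable[of w "range e"] by (auto dest: spec[of _ "\<delta> / 2"])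
    have "norm (?A + canonical_embedding (e k)) =
        norm ((?A + canonical_embedding w) + canonical_embedding (e k - w))"
      by (simp add: canonical_embedding_diff)
    then have "norm (?A + canonical_embedding (e k)) \<le> norm (?A + canonical_embedding w) + norm (e k - w)"
      using norm_triangle_ineq[of "?A + canonical_embedding w" "canonical_embedding (e k - w)"]
        norm_canonical_embedding_le[of "e k - w"] by linarith
    moreover have "norm w \<le> norm (e k) + norm (e k - w)"
      using norm_triangle_ineq4[of "e k" "e k - w"] by simp
    ultimately show "1 + norm w \<le> norm (?A + canonical_embedding w) + \<delta>"
      using lower_e[of k] k by (simp add: dist_norm)
  qed
  have A: "norm ?A \<le> 1"
    using norm_biadjoint_apply_le[of G v] G(2) v by simp
  have upper: "norm (?A + canonical_embedding w) \<le> 1 + norm w" for w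
    using norm_triangle_ineq[of ?A "canonical_embedding w"] A norm_canonical_embedding_le[of w]
    by simp
  have "canonical_embedding (0 :: 'y) = 0"
    using norm_canonical_embedding_le[of "0 :: 'y"] by simp
  \<comment> \<open>The case \<open>w = 0\<close> closes the chain
    \<open>1 \<le> norm ?A \<le> norm v \<le> 1\<close>.\<close>
  then have "1 \<le> norm ?A"
    using lower[of 0] by simp
  moreover have "norm ?A \<le> norm v"
  proof (rule norm_blinfun_bound)
    fix f :: "'y dual"
    have "norm (f o\<^sub>L G) \<le> norm f"
      using norm_blinfun_compose[of f G] G(2) by simp
    then have "norm v * norm (f o\<^sub>L G) \<le> norm v * norm f"
      by (intro mult_left_mono) auto
    then show "norm (blinfun_apply ?A f) \<le> norm v * norm f"
      using norm_blinfun[of v "f o\<^sub>L G"] by (simp add: biadjoint_apply)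
  qed simp
  ultimately have "norm v = 1"
    using v by simp
  moreover have "norm (?A + canonical_embedding w) = 1 + norm w" for w
    using upper lower by (rule antisym)
  ultimately show ?thesis
    using vg that by blast
qed

text \<open>A basic product neighbourhood restricts finitely many coordinates, and exact agreement
  with \<open>u\<close> on those is enough to stay inside. This reduces the claim on open sets to
  interpolation.\<close>

lemma weak_star_open_contains_agreement_set:
  fixes W :: "'a::real_normed_vector dual set"
  assumes "openin weak_star_topology W" "u \<in> W"
  obtains F where "finite F"
    "\<And>v. (\<And>a. a \<in> F \<Longrightarrow> blinfun_apply v a = blinfun_apply u a) \<Longrightarrow> v \<in> W"
proof -
  obtain U where U: "openin (product_topology (\<lambda>i. euclidean) UNIV) U" "W = blinfun_apply -` U"
    using assms(1)
    by (auto simp: strong_operator_topology_def openin_pullback_topology euclidean_product_topology)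
  then obtain X where X: "blinfun_apply u \<in> (\<Pi>\<^sub>E i\<in>UNIV. X i)" "finite {i. X i \<noteq> UNIV}"
    "(\<Pi>\<^sub>E i\<in>UNIV. X i) \<subseteq> U"
    using product_topology_open_contains_basis[OF U(1), of "blinfun_apply u"] assms(2) by auto
  show ?thesis
  proof (rule that[OF X(2)])
    fix v assume v: "\<And>a. a \<in> {i. X i \<noteq> UNIV} \<Longrightarrow> blinfun_apply v a = blinfun_apply u a"
    have "blinfun_apply v a \<in> X a" for a
      using v[of a] X(1) by (cases "X a = UNIV") (auto simp: PiE_def)
    then show "v \<in> W"
      using X(3) U(2) by (auto simp: PiE_def)
  qed
qed

theorem theorem3p5:
  fixes G :: "'x::banach \<Rightarrow>\<^sub>L 'y::banach"
  assumes "daugavet_center G"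
    and "norm G = 1"
    and "separable_space (euclidean :: 'y topology)"
  shows "(\<forall>u \<in> cball (0 :: 'x bidual) 1. \<forall>g :: nat \<Rightarrow> 'x dual. range g \<subseteq> sphere 0 1 \<longrightarrow>
            (\<exists>v \<in> sphere (0 :: 'x bidual) 1.
                (\<forall>n. blinfun_apply v (g n) = blinfun_apply u (g n)) \<and>
                (\<forall>y :: 'y. norm (biadjoint G v + canonical_embedding y) = 1 + norm y)))
       \<and> (\<forall>W :: 'x bidual set.
            openin (subtopology weak_star_topology (cball 0 1)) W \<and> W \<noteq> {} \<longrightarrow>
            (\<exists>v \<in> W. \<forall>y :: 'y. norm (biadjoint G v + canonical_embedding y) = 1 + norm y))"
proof (intro conjI ballI allI impI)
  fix u :: "'x bidual" and g :: "nat \<Rightarrow> 'x dual"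
  assume u: "u \<in> cball 0 1" and g: "range g \<subseteq> sphere 0 1"
  have "norm (g n) \<le> 1" for n
    using g by (auto simp: image_subset_iff)
  then obtain v where "norm v = 1" "\<And>n. blinfun_apply v (g n) = blinfun_apply u (g n)"
    "\<And>y. norm (biadjoint G v + canonical_embedding y) = 1 + norm y"
    using daugavet_center_L_orthogonal[OF assms, of u g] u by auto
  then show "\<exists>v \<in> sphere (0 :: 'x bidual) 1.
      (\<forall>n. blinfun_apply v (g n) = blinfun_apply u (g n)) \<and>
      (\<forall>y :: 'y. norm (biadjoint G v + canonical_embedding y) = 1 + norm y)"
    by (intro bexI[of _ v]) auto
next
  fix W :: "'x bidual set"
  assume W: "openin (subtopology weak_star_topology (cball 0 1)) W \<and> W \<noteq> {}"
  then obtain T where T: "openin weak_star_topology T" "W = T \<inter> cball 0 1"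
    by (auto simp: openin_subtopology)
  with W obtain u where u: "u \<in> T" "norm u \<le> 1"
    by auto
  obtain F where F: "finite F"
    "\<And>v. (\<And>a. a \<in> F \<Longrightarrow> blinfun_apply v a = blinfun_apply u a) \<Longrightarrow> v \<in> T"
    using weak_star_open_contains_agreement_set[OF T(1) u(1)] by blast
  \<comment> \<open>Normalising with \<open>sgn\<close> keeps the functionals in the unit ball, and
    agreement at \<open>sgn a\<close> scales back to \<open>a\<close>. Inserting \<open>0\<close>
    makes the enumerated set nonempty.\<close>
  define g where "g = from_nat_into (insert 0 (sgn ` F))"
  have range_g: "range g = insert 0 (sgn ` F)"
    unfolding g_def using F(1) by (intro range_from_nat_into) (auto intro: countable_finite)
  have "norm (g n) \<le> 1" for n
  proof -
    have "g n \<in> insert 0 (sgn ` F)"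
      using range_g by auto
    then show ?thesis
      by (auto simp: norm_sgn)
  qed
  then obtain v where v: "norm v = 1" "\<And>n. blinfun_apply v (g n) = blinfun_apply u (g n)"
    "\<And>y. norm (biadjoint G v + canonical_embedding y) = 1 + norm y"
    using daugavet_center_L_orthogonal[OF assms u(2), of g] by auto
  have "blinfun_apply v a = blinfun_apply u a" if "a \<in> F" for a
  proof -
    have "sgn a \<in> range g"
      using that range_g by auto
    then have "blinfun_apply v (sgn a) = blinfun_apply u (sgn a)"
      using v(2) by auto
    moreover have "a = norm a *\<^sub>R sgn a"
      by (cases "a = 0") (auto simp: sgn_div_norm)
    ultimately show ?thesis
      by (metis blinfun.scaleR_right)
  qed
  then have "v \<in> W"
    using F(2) T(2) v(1) by auto
  with v(3) show "\<exists>v \<in> W. \<forall>y :: 'y. norm (biadjoint G v + canonical_embedding y) = 1 + norm y"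
    by blast
qed

end
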